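(* Let $A,B\in\mathcal M_{m\times n}$ and suppose the Kronecker canonical form of the pencil $\lambda B-A$ is $$P(\lambda B-A)Q=K(\lambda)=\mathrm{diag}\left(L_{\epsilon_1},\dots,L_{\epsilon_p},L^{\mathrm T}_{\eta_1},\dots,L^{\mathrm T}_{\eta_q},N_{\alpha_1},\dots,N_{\alpha_r},J^{\beta_1},\dots,J^{\beta_s}\right)$$ with $P$ ($m\times m$) and $Q$ ($n\times n$) nonsingular. Decompose the columns of $Q$ according to the column blocks of $K(\lambda)$: $$Q=[Q_{\epsilon_1},\dots,Q_{\epsilon_p},Q_{\eta_1},\dots,Q_{\eta_q},Q_{\alpha_1},\dots,Q_{\alpha_r},Q_{\beta_1},\dots,Q_{\beta_s}].$$ Then: (i) Corresponding to each $\epsilon_i=0$, $Q_{\epsilon_i}$ is a set of vector-free eigenvectors corresponding to the eigenvalue $\lambda=0$. (ii) Corresponding to each $\epsilon_i>0$, $Q_{\epsilon_i}$ is a value-free eigenvector corresponding to an arbitrarily given eigenvalue $\lambda\in\mathbb C$. (iii) Corresponding to each Jordan block of $K(\lambda)$ of size $b$ with eigenvalue $\lambda_i$, the columns of $Q$ belonging to that block form a chain, containing an eigenvector and $b-1$ root vectors, corresponding to the eigenvalue $\lambda_i$. Moreover, all the eigenvalues/eigenvectors of $A$ with respect to $B$ are of the forms (i)-(iii).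
   Context: $\mathcal M_{m\times n}$ is the set of $m\times n$ real matrices. The matrices $P,Q$ are allowed to be complex. Eigenvalues and eigenvectors: a vector $0\neq x\in\mathbb C^n$ is an eigenvector of $A$ with respect to the type $B$ and the eigenvalue $\lambda_0\in\mathbb C$ if $(\lambda_0B-A)x=0$. Kronecker canonical form: for any $A,B\in\mathcal M_{m\times n}$ there are nonsingular $P,Q$ such that $P(\lambda B-A)Q=K(\lambda)$ is block diagonal with blocks of the following types. - $L_0$: a block consisting of some number $\ell$ of zero columns (and no rows). For $\epsilon\ge1$, $L_\epsilon$ is the $\epsilon\times(\epsilon+1)$ matrix with $(k,k)$ entry $\lambda$, $(k,k+1)$ entry $-1$, and all other entries $0$. - $L^{\mathrm T}_0$: a block consisting of some number of zero rows (and no columns). For $\eta\ge1$, $L_\eta^{\mathrm T}$ is the $(\eta+1)\times\eta$ matrix with $(k,k)$ entry $-1$, $(k+1,k)$ entry $\lambda$, and all other entries $0$. - $N_\alpha$ ($\alpha\ge1$): the $\alpha\times\alpha$ matrix with $-1$ on the diagonal, $\lambda$ on the first subdiagonal, and all other entries $0$. - $J^{\beta_i}$: a block diagonal matrix of Jordan blocks with eigenvalue $\lambda_i\in\mathbb C$; a Jordan block of size $b$ with eigenvalue $\lambda_i$ is the $b\times b$ matrix with $\lambda-\lambda_i$ on the diagonal, $-1$ on the first subdiagonal, and all other entries $0$. Vector-free eigenvectors: if $\epsilon_i=0$ and the block $L_0$ has $\ell>0$ zero columns, this means that for every $0\ne z\in\mathbb C^{\ell}$ (chosen arbitrarily) the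 vector $Q_{\epsilon_i}z$ is an eigenvector, with eigenvalue zero. Value-free eigenvector: if $\epsilon_i=r>0$, this means that the eigenvalue $\lambda\in\mathbb C$ can be chosen arbitrarily, and the corresponding eigenvector is the polynomial in $\lambda$ given by $Q_{\epsilon_i}(1,\lambda,\dots,\lambda^r)^{\mathrm T}$. Chain: vectors $x_1,\dots,x_b$ form a chain consisting of an eigenvector $x_1$ and root vectors $x_2,\dots,x_b$ for the eigenvalue $\lambda_i$ if they are nonzero and $(A-\lambda_iB)x_1=0$, $(A-\lambda_iB)x_k=Bx_{k-1}$ for $k=2,\dots,b$. With the (lower triangular) block convention above, $x_1$ is the last column of $Q$ belonging to the Jordan block, $x_2$ the preceding one, and so on.
   Formalization: In the "moreover" part, eigenvectors for an eigenvalue z are shown to be linear combinations of the vectors in (i)-(iii) belonging to z, with vector-free eigenvectors allowed for every z and not only 0; the literal claim fails, e.g. for A=B=0, z=1. *)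

theory Defs
  imports "Jordan_Normal_Form.VS_Connect"
begin

abbreviation cmat :: "real mat \<Rightarrow> complex mat"
  where "cmat \<equiv> map_mat complex_of_real"

definition pencil :: "real mat \<Rightarrow> real mat \<Rightarrow> complex \<Rightarrow> complex mat"
  where "pencil A B z = z \<cdot>\<^sub>m cmat B - cmat A"

definition eigenvector_wrt :: "real mat \<Rightarrow> real mat \<Rightarrow> complex \<Rightarrow> complex vec \<Rightarrow> bool"
  where "eigenvector_wrt A B z x \<longleftrightarrow>
    x \<in> carrier_vec (dim_col A) \<and> x \<noteq> 0\<^sub>v (dim_col A) \<and>
    pencil A B z *\<^sub>v x = 0\<^sub>v (dim_row A)"

definition eigenvalue_wrt :: "real mat \<Rightarrow> real mat \<Rightarrow> complex \<Rightarrow> bool"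
  where "eigenvalue_wrt A B z \<longleftrightarrow> (\<exists>x. eigenvector_wrt A B z x)"


text \<open>
  The canonical blocks are matrices over \<open>complex poly\<close>; the indeterminate \<open>[:0, 1:]\<close> plays the
  role of \<open>\<lambda>\<close>, and \<open>eval_mat K z\<close> is \<open>K(z)\<close>. Row and column indices start at 0.
\<close>

definition eval_mat :: "complex poly mat \<Rightarrow> complex \<Rightarrow> complex mat"
  where "eval_mat K z = map_mat (\<lambda>f. poly f z) K"

text \<open>
  The second argument is used only for \<open>L\<^sub>0\<close> (and for its transpose), whose number of zero columns
  (zero rows) is not determined by the index.
\<close>

definition L_block :: "nat \<Rightarrow> nat \<Rightarrow> complex poly mat"
  where "L_block e l =
    (if e = 0 then 0\<^sub>m 0 l
     else mat e (e + 1) (\<lambda>(i, j). if i = j then [:0, 1:] else if j = i + 1 then -1 else 0))"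

definition LT_block :: "nat \<Rightarrow> nat \<Rightarrow> complex poly mat"
  where "LT_block h k =
    (if h = 0 then 0\<^sub>m k 0
     else mat (h + 1) h (\<lambda>(i, j). if i = j then -1 else if i = j + 1 then [:0, 1:] else 0))"

definition N_block :: "nat \<Rightarrow> complex poly mat"
  where "N_block a = mat a a (\<lambda>(i, j). if i = j then -1 else if i = j + 1 then [:0, 1:] else 0)"

text \<open>The pencil \<open>\<lambda> I - J\<close> of a single lower triangular Jordan block \<open>J\<close>.\<close>

definition jordan_pencil :: "complex \<Rightarrow> nat \<Rightarrow> complex poly mat"
  where "jordan_pencil c b =
    mat b b (\<lambda>(i, j). if i = j then [:- c, 1:] else if i = j + 1 then -1 else 0)"

definition J_block :: "complex \<Rightarrow> nat list \<Rightarrow> complex poly mat"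
  where "J_block c bs = diag_block_mat (map (jordan_pencil c) bs)"

text \<open>
  The columns of \<open>Q\<close> that meet the \<open>i\<close>-th diagonal block of \<open>diag_block_mat Ks\<close>.
\<close>

definition column_block :: "complex mat \<Rightarrow> complex poly mat list \<Rightarrow> nat \<Rightarrow> complex mat"
  where "column_block Q Ks i =
    (let d = sum_list (map dim_col (take i Ks))
     in mat_of_cols (dim_row Q) (map (col Q) [d ..< d + dim_col (Ks ! i)]))"


definition vector_free_eigenvectors :: "real mat \<Rightarrow> real mat \<Rightarrow> nat \<Rightarrow> complex mat \<Rightarrow> bool"
  where "vector_free_eigenvectors A B l M \<longleftrightarrow>
    (\<forall>z \<in> carrier_vec l. z \<noteq> 0\<^sub>v l \<longrightarrow> eigenvector_wrt A B 0 (M *\<^sub>v z))"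

definition power_vec :: "nat \<Rightarrow> complex \<Rightarrow> complex vec"
  where "power_vec r z = vec (r + 1) (\<lambda>k. z ^ k)"

definition value_free_eigenvector :: "real mat \<Rightarrow> real mat \<Rightarrow> nat \<Rightarrow> complex mat \<Rightarrow> bool"
  where "value_free_eigenvector A B r M \<longleftrightarrow>
    (\<forall>z. eigenvector_wrt A B z (M *\<^sub>v power_vec r z))"

definition root_chain :: "real mat \<Rightarrow> real mat \<Rightarrow> complex \<Rightarrow> complex vec list \<Rightarrow> bool"
  where "root_chain A B c xs \<longleftrightarrow>
    (\<forall>x \<in> set xs. x \<in> carrier_vec (dim_col A) \<and> x \<noteq> 0\<^sub>v (dim_col A)) \<and>
    xs \<noteq> [] \<and>
    (cmat A - c \<cdot>\<^sub>m cmat B) *\<^sub>v (xs ! 0) = 0\<^sub>v (dim_row A) \<and>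
    (\<forall>k. 1 \<le> k \<and> k < length xs \<longrightarrow>
      (cmat A - c \<cdot>\<^sub>m cmat B) *\<^sub>v (xs ! k) = cmat B *\<^sub>v (xs ! (k - 1)))"

text \<open>
  The blocks are lower triangular, so the eigenvector is the last column belonging to the block and
  the chain runs through the columns from right to left.
\<close>

definition chain_vectors :: "complex mat \<Rightarrow> complex \<Rightarrow> nat list \<Rightarrow> nat \<Rightarrow> complex vec list"
  where "chain_vectors M c bs j = rev (cols (column_block M (map (jordan_pencil c) bs) j))"

abbreviation cspan :: "nat \<Rightarrow> complex vec set \<Rightarrow> complex vec set"
  where "cspan n \<equiv> LinearCombinations.module.span class_ring (module_vec TYPE(complex) n)"

end

theory Submission
  imports Defs "Jordan_Normal_Form.Matrix_Kernel"
begin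

text \<open>
  Write \<open>x = Q y\<close>. Since \<open>P\<close> and \<open>Q\<close> are nonsingular, \<open>(z B - A) x = 0\<close> is equivalent to
  \<open>K(z) y = 0\<close>, and as \<open>K(z)\<close> is block diagonal this holds exactly when every block kills its part
  of \<open>y\<close>. So the whole theorem reduces to computing the kernel of each canonical block:
  blocks \<open>L\<^sub>0\<close> kill everything; \<open>L\<^sub>e v = 0\<close> is the recursion \<open>v\<^sub>i\<^sub>+\<^sub>1 = z v\<^sub>i\<close>, so \<open>v\<close> is a multiple of
  \<open>(1, z, ..., z\<^sup>e)\<close> (\<open>kernel_L_block\<close>); the transposed blocks, the \<open>N\<close> blocks and, for \<open>z\<close> different
  from their eigenvalue, the Jordan blocks are lower bidiagonal with a nonzero diagonal and have no
  kernel (\<open>kernel_lower_bidiagonal\<close>); and a Jordan block at its own eigenvalue kills just the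
  multiples of the last unit vector (\<open>kernel_jordan_pencil\<close>).

  Two observations transport this to \<open>A\<close> and \<open>B\<close>. In one direction, with \<open>R\<close> the inverse of \<open>P\<close>, the
  canonical form says \<open>(z B - A) Q = R K(z)\<close> for all \<open>z\<close>, with \<open>R\<close> independent of \<open>z\<close>. Such an identity
  is inherited by the columns of \<open>Q\<close> that belong to one diagonal block, with a block of columns of \<open>R\<close>
  on the right (\<open>intertwines_column_block\<close>). This gives the eigenvectors, and for a Jordan block,
  comparing the coefficients of \<open>z\<close>, the chain relations (\<open>intertwined_jordan_columns\<close>). The vectors
  obtained are nonzero because \<open>Q\<close>, hence each of its column blocks, is injective.

  In the other direction \<open>Q y\<close> is the sum of the images of the parts of \<open>y\<close> under the column blocks,
  so it lies in any span that contains the images of the kernels of the single blocks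
  (\<open>kernel_eval_diag_in_cspan\<close>). A Jordan block \<open>J_block\<close> with several cells is itself block diagonal,
  so both observations are used twice. Finally, if no block admits \<open>z\<close> as an eigenvalue, then
  the generating set is empty, its span is zero, and \<open>z\<close> has no eigenvector.
\<close>

section \<open>Column slices\<close>

text \<open>
  \<open>column_block\<close> refers to the sum of the preceding block widths. Slices with an explicit offset can
  be taken repeatedly, which makes induction on the list of blocks possible: peeling off the
  first block leaves the blocks of the remaining slice.
\<close>

definition column_slice :: "complex mat \<Rightarrow> nat \<Rightarrow> nat \<Rightarrow> complex mat"
  where "column_slice Q a d = mat_of_cols (dim_row Q) (map (col Q) [a ..< a + d])"

lemma column_slice_carrier [simp]: "column_slice Q a d \<in> carrier_mat (dim_row Q) d"
  by (rule carrier_matI) (simp_all add: column_slice_def)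

lemma dim_column_slice [simp]:
  "dim_row (column_slice Q a d) = dim_row Q" "dim_col (column_slice Q a d) = d"
  by (simp_all add: column_slice_def)

lemma column_slice_index:
  assumes "i < dim_row Q" "j < d" "a + d \<le> dim_col Q"
  shows "column_slice Q a d $$ (i, j) = Q $$ (i, a + j)"
  using assms by (simp add: column_slice_def mat_of_cols_index)

lemma column_block_slice:
  "column_block Q Ks i = column_slice Q (\<Sum>K\<leftarrow>take i Ks. dim_col K) (dim_col (Ks ! i))"
  by (simp add: column_block_def column_slice_def Let_def)

lemma column_block_carrier [simp]:
  "column_block Q Ks i \<in> carrier_mat (dim_row Q) (dim_col (Ks ! i))"
  by (simp add: column_block_slice)

lemma column_slice_slice:
  assumes "b + e \<le> d" "a + d \<le> dim_col Q"
  shows "column_slice (column_slice Q a d) b e = column_slice Q (a + b) e"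
  using assms by (intro eq_matI) (simp_all add: column_slice_index add.assoc)

lemma column_block_Cons_0: "column_block Q (K # Ks) 0 = column_slice Q 0 (dim_col K)"
  by (simp add: column_block_slice)

lemma column_block_Cons_Suc:
  assumes "dim_col Q = dim_col K + (\<Sum>K\<leftarrow>Ks. dim_col K)" "i < length Ks"
  shows "column_block Q (K # Ks) (Suc i) =
         column_block (column_slice Q (dim_col K) (\<Sum>K\<leftarrow>Ks. dim_col K)) Ks i"
proof -
  have "(\<Sum>K\<leftarrow>Ks. dim_col K) = (\<Sum>K\<leftarrow>take i Ks @ Ks ! i # drop (Suc i) Ks. dim_col K)"
    using assms(2) by (simp add: id_take_nth_drop[symmetric])
  then have "(\<Sum>K\<leftarrow>take i Ks. dim_col K) + dim_col (Ks ! i) \<le> (\<Sum>K\<leftarrow>Ks. dim_col K)"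
    by simp
  then show ?thesis
    using assms by (simp add: column_block_slice column_slice_slice)
qed

lemma mult_vec_append:
  assumes Q: "Q \<in> carrier_mat n (a + b)" and u: "u \<in> carrier_vec a" and w: "w \<in> carrier_vec b"
  shows "Q *\<^sub>v (u @\<^sub>v w) = column_slice Q 0 a *\<^sub>v u + column_slice Q a b *\<^sub>v w"
proof (rule eq_vecI)
  fix i assume "i < dim_vec (column_slice Q 0 a *\<^sub>v u + column_slice Q a b *\<^sub>v w)"
  then have i: "i < n" using Q by simp
  have "row Q i = row (column_slice Q 0 a) i @\<^sub>v row (column_slice Q a b) i"
    using Q i by (intro eq_vecI) (auto simp: column_slice_index)
  then have "row Q i \<bullet> (u @\<^sub>v w) =
      row (column_slice Q 0 a) i \<bullet> u + row (column_slice Q a b) i \<bullet> w"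
    by (simp add: scalar_prod_append[OF row_carrier row_carrier] u w)
  then show "(Q *\<^sub>v (u @\<^sub>v w)) $ i = (column_slice Q 0 a *\<^sub>v u + column_slice Q a b *\<^sub>v w) $ i"
    using Q i by simp
qed (use Q in simp)

corollary mult_vec_append_zero:
  assumes Q: "Q \<in> carrier_mat n (a + b)"
  shows "u \<in> carrier_vec a \<Longrightarrow> Q *\<^sub>v (u @\<^sub>v 0\<^sub>v b) = column_slice Q 0 a *\<^sub>v u"
    and "w \<in> carrier_vec b \<Longrightarrow> Q *\<^sub>v (0\<^sub>v a @\<^sub>v w) = column_slice Q a b *\<^sub>v w"
proof -
  have c: "column_slice Q x y \<in> carrier_mat n y" for x y
    using Q column_slice_carrier[of Q] by simp
  have z: "column_slice Q x y *\<^sub>v 0\<^sub>v y = 0\<^sub>v n" for x y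
    using Q by (intro eq_vecI) auto
  show "u \<in> carrier_vec a \<Longrightarrow> Q *\<^sub>v (u @\<^sub>v 0\<^sub>v b) = column_slice Q 0 a *\<^sub>v u"
    using mult_vec_append[OF Q, of u "0\<^sub>v b"] mult_mat_vec_carrier[OF c] by (simp add: z)
  show "w \<in> carrier_vec b \<Longrightarrow> Q *\<^sub>v (0\<^sub>v a @\<^sub>v w) = column_slice Q a b *\<^sub>v w"
    using mult_vec_append[OF Q, of "0\<^sub>v a" w] mult_mat_vec_carrier[OF c] by (simp add: z)
qed

lemma append_zero_eq_zero:
  fixes u w :: "complex vec"
  assumes "u \<in> carrier_vec a" "w \<in> carrier_vec b"
  shows "u @\<^sub>v w = 0\<^sub>v (a + b) \<longleftrightarrow> u = 0\<^sub>v a \<and> w = 0\<^sub>v b"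
proof -
  have "(0\<^sub>v (a + b) :: complex vec) = 0\<^sub>v a @\<^sub>v 0\<^sub>v b" by (intro eq_vecI) auto
  with append_vec_eq[OF assms(1), of "0\<^sub>v a"] show ?thesis using assms by simp
qed

text \<open>
  Padding a vector with zeros turns a slice of \<open>Q\<close> into \<open>Q\<close> itself, so slices inherit injectivity.
\<close>

lemma kernel_column_slices_trivial:
  assumes Q: "Q \<in> carrier_mat n (a + b)" and inj: "mat_kernel Q \<subseteq> {0\<^sub>v (a + b)}"
  shows "mat_kernel (column_slice Q 0 a) \<subseteq> {0\<^sub>v a}"
    and "mat_kernel (column_slice Q a b) \<subseteq> {0\<^sub>v b}"
proof -
  have *: "v = 0\<^sub>v (a + b)" if "v \<in> carrier_vec (a + b)" "Q *\<^sub>v v = 0\<^sub>v n" for v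
    using inj mat_kernelI[OF Q that] by auto
  have "u = 0\<^sub>v a" if "u \<in> mat_kernel (column_slice Q 0 a)" for u
  proof -
    from that have u: "u \<in> carrier_vec a" and 0: "column_slice Q 0 a *\<^sub>v u = 0\<^sub>v n"
      using Q by (simp_all add: mat_kernel_def)
    have "u @\<^sub>v 0\<^sub>v b = 0\<^sub>v (a + b)"
      by (rule *) (use 0 u in \<open>simp_all add: mult_vec_append_zero(1)[OF Q]\<close>)
    then show ?thesis using append_zero_eq_zero[OF u, of "0\<^sub>v b"] by simp
  qed
  then show "mat_kernel (column_slice Q 0 a) \<subseteq> {0\<^sub>v a}" by blast
  have "w = 0\<^sub>v b" if "w \<in> mat_kernel (column_slice Q a b)" for w
  proof -
    from that have w: "w \<in> carrier_vec b" and 0: "column_slice Q a b *\<^sub>v w = 0\<^sub>v n"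
      using Q by (simp_all add: mat_kernel_def)
    have "0\<^sub>v a @\<^sub>v w = 0\<^sub>v (a + b)"
      by (rule *) (use 0 w in \<open>simp_all add: mult_vec_append_zero(2)[OF Q]\<close>)
    then show ?thesis using append_zero_eq_zero[OF _ w, of "0\<^sub>v a"] by simp
  qed
  then show "mat_kernel (column_slice Q a b) \<subseteq> {0\<^sub>v b}" by blast
qed

section \<open>Spans\<close>

lemma cspan_zero: "0\<^sub>v n \<in> cspan n S"
proof -
  interpret vec_space "TYPE(complex)" n .
  show ?thesis by (rule span_zero)
qed

lemma cspan_base: "S \<subseteq> carrier_vec n \<Longrightarrow> x \<in> S \<Longrightarrow> x \<in> cspan n S"
proof -
  interpret vec_space "TYPE(complex)" n .
  show "S \<subseteq> carrier_vec n \<Longrightarrow> x \<in> S \<Longrightarrow> x \<in> cspan n S"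
    using in_own_span by blast
qed

lemma cspan_add:
  assumes "S \<subseteq> carrier_vec n" "x \<in> cspan n S" "y \<in> cspan n S"
  shows "x + y \<in> cspan n S"
proof -
  interpret vec_space "TYPE(complex)" n .
  show ?thesis using assms by (rule span_add1)
qed

lemma cspan_smult:
  assumes "S \<subseteq> carrier_vec n" "x \<in> cspan n S"
  shows "c \<cdot>\<^sub>v x \<in> cspan n S"
proof -
  interpret vec_space "TYPE(complex)" n .
  show ?thesis using assms by (rule smult_in_span)
qed

lemma cspan_empty: "cspan n {} = {0\<^sub>v n}"
proof -
  interpret vec_space "TYPE(complex)" n .
  show ?thesis by (rule span_empty)
qed

section \<open>Block diagonal pencils\<close>

lemma dim_eval_mat [simp]:
  "dim_row (eval_mat K z) = dim_row K" "dim_col (eval_mat K z) = dim_col K"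
  by (simp_all add: eval_mat_def)

lemma eval_mat_carrier [simp]: "eval_mat K z \<in> carrier_mat (dim_row K) (dim_col K)"
  by (rule carrier_matI) simp_all

lemma eval_diag_Cons_mult_vec:
  assumes "u \<in> carrier_vec (dim_col K)" "w \<in> carrier_vec (dim_col (diag_block_mat Ks))"
  shows "eval_mat (diag_block_mat (K # Ks)) z *\<^sub>v (u @\<^sub>v w) =
         (eval_mat K z *\<^sub>v u) @\<^sub>v (eval_mat (diag_block_mat Ks) z *\<^sub>v w)"
proof -
  let ?D = "diag_block_mat Ks"
  have "eval_mat (diag_block_mat (K # Ks)) z =
     four_block_mat (eval_mat K z) (0\<^sub>m (dim_row K) (dim_col ?D)) (0\<^sub>m (dim_row ?D) (dim_col K))
       (eval_mat ?D z)"
    by (intro eq_matI) (auto simp: eval_mat_def Let_def)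
  also have "\<dots> *\<^sub>v (u @\<^sub>v w) =
      (eval_mat K z *\<^sub>v u + 0\<^sub>m (dim_row K) (dim_col ?D) *\<^sub>v w) @\<^sub>v
      (0\<^sub>m (dim_row ?D) (dim_col K) *\<^sub>v u + eval_mat ?D z *\<^sub>v w)"
    using assms
    by (intro four_block_mat_mult_vec[of _ "dim_row K" _ _ _ _ "dim_row ?D"]) simp_all
  also have "\<dots> = (eval_mat K z *\<^sub>v u) @\<^sub>v (eval_mat ?D z *\<^sub>v w)"
    using assms by (intro eq_vecI) auto
  finally show ?thesis .
qed

lemma kernel_eval_diag_Cons:
  assumes "v \<in> mat_kernel (eval_mat (diag_block_mat (K # Ks)) z)"
  obtains u w where "v = u @\<^sub>v w" "u \<in> mat_kernel (eval_mat K z)"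
    "w \<in> mat_kernel (eval_mat (diag_block_mat Ks) z)"
proof -
  let ?D = "diag_block_mat Ks"
  have dims: "dim_row (diag_block_mat (K # Ks)) = dim_row K + dim_row ?D"
    "dim_col (diag_block_mat (K # Ks)) = dim_col K + dim_col ?D"
    by (simp_all add: Let_def)
  define u where "u = vec_first v (dim_col K)"
  define w where "w = vec_last v (dim_col ?D)"
  have v: "v \<in> carrier_vec (dim_col K + dim_col ?D)"
    and 0: "eval_mat (diag_block_mat (K # Ks)) z *\<^sub>v v = 0\<^sub>v (dim_row K + dim_row ?D)"
    using assms dims by (simp_all add: mat_kernel_def)
  have uw: "v = u @\<^sub>v w" "u \<in> carrier_vec (dim_col K)" "w \<in> carrier_vec (dim_col ?D)"
    using v by (simp_all add: u_def w_def)
  have ev: "eval_mat L z *\<^sub>v x \<in> carrier_vec (dim_row L)" for L z x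
    by (rule carrier_vecI) simp
  have "(eval_mat K z *\<^sub>v u) @\<^sub>v (eval_mat ?D z *\<^sub>v w) = 0\<^sub>v (dim_row K + dim_row ?D)"
    using 0 uw by (simp add: eval_diag_Cons_mult_vec del: diag_block_mat.simps)
  then have "eval_mat K z *\<^sub>v u = 0\<^sub>v (dim_row K)" "eval_mat ?D z *\<^sub>v w = 0\<^sub>v (dim_row ?D)"
    using append_zero_eq_zero[OF ev ev, of K z u ?D z w] by simp_all
  with uw show thesis by (intro that[of u w]) (simp_all add: mat_kernel_def)
qed

text \<open>
  \<open>intertwines M Q R K\<close> is the identity \<open>M(z) Q = R K(z)\<close> for all \<open>z\<close>. That the same \<open>R\<close> serves
  every \<open>z\<close> is essential: it allows coefficients of \<open>z\<close> to be compared.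
  The identity is stated through its action on vectors, where the block structure acts on appended
  vectors.
\<close>

definition intertwines ::
    "(complex \<Rightarrow> complex mat) \<Rightarrow> complex mat \<Rightarrow> complex mat \<Rightarrow> complex poly mat \<Rightarrow> bool"
  where "intertwines M Q R K \<longleftrightarrow> R \<in> carrier_mat (dim_row R) (dim_row K) \<and>
    (\<forall>z. \<forall>v \<in> carrier_vec (dim_col K). M z *\<^sub>v (Q *\<^sub>v v) = R *\<^sub>v (eval_mat K z *\<^sub>v v))"

text \<open>
  Applying the identity to vectors supported in one block shows that the columns of \<open>Q\<close> in that
  block are carried by \<open>M(z)\<close> to combinations of the corresponding columns of \<open>R\<close>; \<open>R'\<close> consists of
  the latter.
\<close>

lemma intertwines_column_block:
  assumes "intertwines M Q R (diag_block_mat Ks)"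
    and "dim_col Q = dim_col (diag_block_mat Ks)" and "i < length Ks"
  obtains R' where "dim_row R' = dim_row R" "intertwines M (column_block Q Ks i) R' (Ks ! i)"
  using assms
proof (induction Ks arbitrary: Q R i thesis)
  case Nil
  then show ?case by simp
next
  case (Cons K Ks)
  let ?D = "diag_block_mat Ks"
  let ?Q1 = "column_slice Q 0 (dim_col K)" and ?Q2 = "column_slice Q (dim_col K) (dim_col ?D)"
  let ?R1 = "column_slice R 0 (dim_row K)" and ?R2 = "column_slice R (dim_row K) (dim_row ?D)"
  have dims: "dim_row (diag_block_mat (K # Ks)) = dim_row K + dim_row ?D"
    "dim_col (diag_block_mat (K # Ks)) = dim_col K + dim_col ?D"
    by (simp_all add: Let_def)
  have Q: "Q \<in> carrier_mat (dim_row Q) (dim_col K + dim_col ?D)"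
    using Cons.prems(3) dims by auto
  have R: "R \<in> carrier_mat (dim_row R) (dim_row K + dim_row ?D)"
    using Cons.prems(2) dims by (auto simp: intertwines_def)
  \<comment> \<open>Taking \<open>w = 0\<close> or \<open>u = 0\<close> below isolates the first block or the remaining ones.\<close>
  have tw: "M z *\<^sub>v (Q *\<^sub>v (u @\<^sub>v w)) =
      R *\<^sub>v ((eval_mat K z *\<^sub>v u) @\<^sub>v (eval_mat ?D z *\<^sub>v w))"
    if "u \<in> carrier_vec (dim_col K)" "w \<in> carrier_vec (dim_col ?D)" for z u w
    using Cons.prems(2) that dims
    by (simp add: intertwines_def eval_diag_Cons_mult_vec del: diag_block_mat.simps)
  have z: "eval_mat L z *\<^sub>v 0\<^sub>v (dim_col L) = 0\<^sub>v (dim_row L)" for L z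
    by (intro eq_vecI) auto
  have ev: "eval_mat L z *\<^sub>v x \<in> carrier_vec (dim_row L)" for L z x
    by (rule carrier_vecI) simp
  have 1: "intertwines M ?Q1 ?R1 K"
    unfolding intertwines_def
  proof (intro conjI allI ballI)
    fix z and v :: "complex vec" assume v: "v \<in> carrier_vec (dim_col K)"
    show "M z *\<^sub>v (?Q1 *\<^sub>v v) = ?R1 *\<^sub>v (eval_mat K z *\<^sub>v v)"
      using tw[OF v, of "0\<^sub>v (dim_col ?D)" z] v
      by (simp add: mult_vec_append_zero[OF Q] mult_vec_append_zero[OF R] z ev)
  qed simp
  have 2: "intertwines M ?Q2 ?R2 ?D"
    unfolding intertwines_def
  proof (intro conjI allI ballI)
    fix z and v :: "complex vec" assume v: "v \<in> carrier_vec (dim_col ?D)"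
    show "M z *\<^sub>v (?Q2 *\<^sub>v v) = ?R2 *\<^sub>v (eval_mat ?D z *\<^sub>v v)"
      using tw[OF _ v, of "0\<^sub>v (dim_col K)" z] v
      by (simp add: mult_vec_append_zero[OF Q] mult_vec_append_zero[OF R] z ev)
  qed simp
  show ?case
  proof (cases i)
    case 0
    then show ?thesis using Cons.prems(1)[of ?R1] 1 by (simp add: column_block_Cons_0)
  next
    case (Suc j)
    with Cons.prems have j: "j < length Ks" by simp
    have "column_block Q (K # Ks) (Suc j) = column_block ?Q2 Ks j"
      using column_block_Cons_Suc[OF _ j, of Q K] Q by (simp add: dim_diag_block_mat)
    moreover obtain R' where "dim_row R' = dim_row ?R2"
      "intertwines M (column_block ?Q2 Ks j) R' (Ks ! j)"
      using Cons.IH[OF _ 2 _ j] by auto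
    ultimately show ?thesis using Cons.prems(1)[of R'] Suc by simp
  qed
qed

lemma kernel_column_block_trivial:
  assumes "dim_col Q = dim_col (diag_block_mat Ks)" "i < length Ks"
    and "mat_kernel Q \<subseteq> {0\<^sub>v (dim_col Q)}"
  shows "mat_kernel (column_block Q Ks i) \<subseteq> {0\<^sub>v (dim_col (Ks ! i))}"
  using assms
proof (induction Ks arbitrary: Q i)
  case Nil
  then show ?case by simp
next
  case (Cons K Ks)
  let ?D = "diag_block_mat Ks"
  have Q: "Q \<in> carrier_mat (dim_row Q) (dim_col K + dim_col ?D)"
    using Cons.prems by (auto simp: Let_def)
  note inj = kernel_column_slices_trivial[OF Q]
  show ?case
  proof (cases i)
    case 0
    then show ?thesis using inj Q Cons.prems by (simp add: column_block_Cons_0)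
  next
    case (Suc j)
    with Cons.prems have j: "j < length Ks" by simp
    have "column_block Q (K # Ks) (Suc j) =
        column_block (column_slice Q (dim_col K) (dim_col ?D)) Ks j"
      using column_block_Cons_Suc[OF _ j, of Q K] Q by (simp add: dim_diag_block_mat)
    then show ?thesis using Cons.IH[OF _ j] Suc inj(2) Q Cons.prems by simp
  qed
qed

text \<open>
  A kernel vector of the block diagonal matrix is the concatenation of kernel vectors of the
  blocks, so its image under \<open>Q\<close> is a sum of images under the column blocks.
\<close>

lemma kernel_eval_diag_in_cspan:
  assumes S: "S \<subseteq> carrier_vec n"
    and "Q \<in> carrier_mat n (dim_col (diag_block_mat Ks))"
    and "\<And>i v. i < length Ks \<Longrightarrow> v \<in> mat_kernel (eval_mat (Ks ! i) z) \<Longrightarrow>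
           column_block Q Ks i *\<^sub>v v \<in> cspan n S"
    and "v \<in> mat_kernel (eval_mat (diag_block_mat Ks) z)"
  shows "Q *\<^sub>v v \<in> cspan n S"
  using assms(2,3,4)
proof (induction Ks arbitrary: Q v)
  case Nil
  have "Q *\<^sub>v v = 0\<^sub>v (n)"
    by (intro eq_vecI) (use Nil in \<open>auto simp: scalar_prod_def mat_kernel_def\<close>)
  then show ?case by (simp add: cspan_zero)
next
  case (Cons K Ks)
  let ?D = "diag_block_mat Ks"
  let ?Q2 = "column_slice Q (dim_col K) (dim_col ?D)"
  have Q: "Q \<in> carrier_mat (n) (dim_col K + dim_col ?D)"
    using Cons.prems by (auto simp: Let_def)
  obtain u w where uw: "v = u @\<^sub>v w" "u \<in> mat_kernel (eval_mat K z)"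
    "w \<in> mat_kernel (eval_mat ?D z)"
    using Cons.prems(3) by (rule kernel_eval_diag_Cons)
  have "?Q2 *\<^sub>v w \<in> cspan n S"
  proof (rule Cons.IH)
    show "column_block ?Q2 Ks i *\<^sub>v x \<in> cspan n S"
      if "i < length Ks" "x \<in> mat_kernel (eval_mat (Ks ! i) z)" for i x
      using Cons.prems(2)[of "Suc i" x] that column_block_Cons_Suc[OF _ that(1), of Q K] Q
      by (simp add: dim_diag_block_mat)
      show "?Q2 \<in> carrier_mat n (dim_col ?D)" using column_slice_carrier[of Q] Q by simp
  qed (rule uw(3))
  moreover have "column_slice Q 0 (dim_col K) *\<^sub>v u \<in> cspan n S"
    using Cons.prems(2)[of 0 u] uw by (simp add: column_block_Cons_0)
  ultimately show ?case
    using mult_vec_append[OF Q, of u w] uw cspan_add[OF S] by (simp add: mat_kernel_def)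
qed


section \<open>Canonical blocks\<close>

lemma mult_mat_vec_nth_sum:
  assumes "i < dim_row M" "v \<in> carrier_vec (dim_col M)"
  shows "(M *\<^sub>v v) $ i = (\<Sum>j<dim_col M. M $$ (i, j) * v $ j)"
  using assms by (auto simp: scalar_prod_def atLeast0LessThan intro!: sum.cong)

lemma smult_mat_mult_vec:
  fixes M :: "complex mat"
  assumes "M \<in> carrier_mat m n" "v \<in> carrier_vec n"
  shows "(c \<cdot>\<^sub>m M) *\<^sub>v v = c \<cdot>\<^sub>v (M *\<^sub>v v)"
  using assms by (intro eq_vecI) (auto simp: scalar_prod_def sum_distrib_left mult.assoc)

lemma mult_mat_vec_unit:
  fixes M :: "complex mat"
  assumes "j < dim_col M"
  shows "M *\<^sub>v unit_vec (dim_col M) j = col M j"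
  using assms by (intro eq_vecI) auto

text \<open>
  The common shape of the transposed \<open>L\<close> blocks (\<open>r = c + 1\<close>), the \<open>N\<close> blocks and the Jordan cells.
\<close>

abbreviation lower_bidiagonal :: "nat \<Rightarrow> nat \<Rightarrow> complex poly \<Rightarrow> complex poly \<Rightarrow> complex poly mat"
  where "lower_bidiagonal r c f g \<equiv>
    mat r c (\<lambda>(i, j). if i = j then f else if i = j + 1 then g else 0)"

lemma lower_bidiagonal_mult_vec:
  assumes v: "v \<in> carrier_vec c" and i: "i < r" and r: "r \<le> c + 1"
  shows "(eval_mat (lower_bidiagonal r c f g) z *\<^sub>v v) $ i =
    (if i < c then poly f z * v $ i else 0) + (if 0 < i then poly g z * v $ (i - 1) else 0)"
proof -
  have *: "(eval_mat (lower_bidiagonal r c f g) z *\<^sub>v v) $ i =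
      (\<Sum>j<c. eval_mat (lower_bidiagonal r c f g) z $$ (i, j) * v $ j)"
    using mult_mat_vec_nth_sum[of i "eval_mat (lower_bidiagonal r c f g) z" v] v i by simp
  have "(eval_mat (lower_bidiagonal r c f g) z *\<^sub>v v) $ i =
      (\<Sum>j<c. (if j = i then poly f z * v $ j else 0) +
         (if 0 < i \<and> j = i - 1 then poly g z * v $ j else 0))"
    unfolding *
  proof (intro sum.cong refl)
    fix j assume "j \<in> {..<c}"
    then show "eval_mat (lower_bidiagonal r c f g) z $$ (i, j) * v $ j =
        (if j = i then poly f z * v $ j else 0) +
        (if 0 < i \<and> j = i - 1 then poly g z * v $ j else 0)"
      using i by (cases "0 < i") (auto simp: eval_mat_def)
  qed
  also have "\<dots> = (if i < c then poly f z * v $ i else 0) +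
      (if 0 < i then poly g z * v $ (i - 1) else 0)"
    using i r by (cases "0 < i") (auto simp: sum.distrib)
  finally show ?thesis .
qed

text \<open>
  Forward substitution: row \<open>i\<close> expresses \<open>v\<^sub>i\<close> through \<open>v\<^sub>i\<^sub>-\<^sub>1\<close> because the diagonal entry is invertible.
\<close>

lemma kernel_lower_bidiagonal:
  assumes "poly f z \<noteq> 0" "c \<le> r" "r \<le> c + 1"
    and v: "v \<in> mat_kernel (eval_mat (lower_bidiagonal r c f g) z)"
  shows "v = 0\<^sub>v c"
proof -
  have vc: "v \<in> carrier_vec c"
    and 0: "eval_mat (lower_bidiagonal r c f g) z *\<^sub>v v = 0\<^sub>v r"
    using v by (simp_all add: mat_kernel_def)
  have "v $ i = 0" if "i < c" for i
    using that
  proof (induction i)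
    case 0
    then show ?case
      using lower_bidiagonal_mult_vec[OF vc, of 0 r f g z] \<open>eval_mat _ z *\<^sub>v v = _\<close> assms
      by (simp del: index_mult_mat_vec)
  next
    case (Suc i)
    then show ?case
      using lower_bidiagonal_mult_vec[OF vc, of "Suc i" r f g z] 0 assms by (simp del: index_mult_mat_vec)
  qed
  then show ?thesis using vc by (intro eq_vecI) auto
qed

lemma kernel_LT_block: "v \<in> mat_kernel (eval_mat (LT_block h k) z) \<Longrightarrow> v = 0\<^sub>v h"
  using kernel_lower_bidiagonal[of "-1" z h "h + 1" v "[:0, 1:]"]
  by (cases "h = 0") (auto simp: LT_block_def mat_kernel_def)

lemma kernel_N_block: "v \<in> mat_kernel (eval_mat (N_block a) z) \<Longrightarrow> v = 0\<^sub>v a"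
  using kernel_lower_bidiagonal[of "-1" z a a v "[:0, 1:]"] by (simp add: N_block_def)

lemma kernel_jordan_pencil_other:
  "z \<noteq> c \<Longrightarrow> v \<in> mat_kernel (eval_mat (jordan_pencil c b) z) \<Longrightarrow> v = 0\<^sub>v b"
  using kernel_lower_bidiagonal[of "[:- c, 1:]" z b b v "-1"] by (simp add: jordan_pencil_def)

text \<open>
  At the eigenvalue the diagonal vanishes and row \<open>i + 1\<close> reads \<open>- v\<^sub>i = 0\<close>, which leaves only the
  last coordinate free.
\<close>

lemma kernel_jordan_pencil:
  assumes "b > 0" and v: "v \<in> mat_kernel (eval_mat (jordan_pencil c b) c)"
  shows "v = v $ (b - 1) \<cdot>\<^sub>v unit_vec b (b - 1)"
proof -
  have vc: "v \<in> carrier_vec b" and 0: "eval_mat (jordan_pencil c b) c *\<^sub>v v = 0\<^sub>v b"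
    using v by (simp_all add: mat_kernel_def jordan_pencil_def)
  have "v $ i = 0" if "i < b - 1" for i
    using lower_bidiagonal_mult_vec[OF vc, of "Suc i" b "[:- c, 1:]" "-1" c] 0 that
    by (simp add: jordan_pencil_def del: index_mult_mat_vec)
  then show ?thesis using vc by (intro eq_vecI) auto
qed

text \<open>
  For \<open>i + 1 = b\<close> the vector \<open>unit_vec b (i + 1)\<close> is zero, so the formula also covers the last column.
\<close>

lemma jordan_pencil_mult_unit:
  assumes "i < b"
  shows "eval_mat (jordan_pencil c b) z *\<^sub>v unit_vec b i =
         (z - c) \<cdot>\<^sub>v unit_vec b i - unit_vec b (i + 1)"
proof (rule eq_vecI)
  fix k assume "k < dim_vec ((z - c) \<cdot>\<^sub>v unit_vec b i - unit_vec b (i + 1))"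
  then have k: "k < b" by simp
  then show "(eval_mat (jordan_pencil c b) z *\<^sub>v unit_vec b i) $ k =
      ((z - c) \<cdot>\<^sub>v unit_vec b i - unit_vec b (i + 1)) $ k"
    unfolding jordan_pencil_def
    by (subst lower_bidiagonal_mult_vec) (use assms in \<open>auto simp: unit_vec_def\<close>)
qed (simp add: jordan_pencil_def)

lemma L_block_mult_vec:
  assumes e: "e > 0" and v: "v \<in> carrier_vec (e + 1)" and i: "i < e"
  shows "(eval_mat (L_block e l) z *\<^sub>v v) $ i = z * v $ i - v $ (i + 1)"
proof -
  have *: "(eval_mat (L_block e l) z *\<^sub>v v) $ i =
      (\<Sum>j<e + 1. eval_mat (L_block e l) z $$ (i, j) * v $ j)"
    using mult_mat_vec_nth_sum[of i "eval_mat (L_block e l) z" v] e v i by (simp add: L_block_def)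
  have "(eval_mat (L_block e l) z *\<^sub>v v) $ i =
      (\<Sum>j<e + 1. (if j = i then z * v $ j else 0) + (if j = i + 1 then - v $ j else 0))"
    unfolding *
  proof (intro sum.cong refl)
    fix j assume "j \<in> {..<e + 1}"
    then show "eval_mat (L_block e l) z $$ (i, j) * v $ j =
        (if j = i then z * v $ j else 0) + (if j = i + 1 then - v $ j else 0)"
      using e i by (auto simp: eval_mat_def L_block_def)
  qed
  also have "\<dots> = z * v $ i - v $ (i + 1)"
    using i by (simp add: sum.distrib del: sum.lessThan_Suc)
  finally show ?thesis .
qed

lemma L_block_mult_power_vec:
  assumes "e > 0"
  shows "eval_mat (L_block e l) z *\<^sub>v power_vec e z = 0\<^sub>v e"
proof (rule eq_vecI)
  have p: "power_vec e z \<in> carrier_vec (e + 1)" by (simp add: power_vec_def)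
  fix i assume "i < dim_vec (0\<^sub>v e :: complex vec)"
  then show "(eval_mat (L_block e l) z *\<^sub>v power_vec e z) $ i = 0\<^sub>v e $ i"
    using L_block_mult_vec[OF assms p, of i] by (simp add: power_vec_def del: index_mult_mat_vec)
qed (use assms in \<open>simp add: L_block_def\<close>)

text \<open>
  The rows of \<open>L\<^sub>e\<close> are the recursion \<open>v\<^sub>i\<^sub>+\<^sub>1 = z v\<^sub>i\<close>, so \<open>v\<close> is determined by its first entry.
\<close>

lemma kernel_L_block:
  assumes e: "e > 0" and v: "v \<in> mat_kernel (eval_mat (L_block e l) z)"
  shows "v = v $ 0 \<cdot>\<^sub>v power_vec e z"
proof -
  have vc: "v \<in> carrier_vec (e + 1)" and 0: "eval_mat (L_block e l) z *\<^sub>v v = 0\<^sub>v e"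
    using v e by (simp_all add: mat_kernel_def L_block_def)
  have pow: "v $ i = v $ 0 * z ^ i" if "i \<le> e" for i
    using that
  proof (induction i)
    case (Suc i)
    then have i: "i < e" and IH: "v $ i = v $ 0 * z ^ i" by simp_all
    have "z * v $ i - v $ (i + 1) = 0"
      using L_block_mult_vec[OF e vc i, of l z] 0 i by (simp del: index_mult_mat_vec)
    then have "v $ Suc i = z * v $ i" by simp
    also have "\<dots> = v $ 0 * z ^ Suc i" unfolding IH by simp
    finally show ?case .
  qed simp
  show ?thesis
  proof (rule eq_vecI)
    fix i assume "i < dim_vec (v $ 0 \<cdot>\<^sub>v power_vec e z)"
    then have "i \<le> e" by (simp add: power_vec_def)
    then show "v $ i = (v $ 0 \<cdot>\<^sub>v power_vec e z) $ i"
      using pow[of i] by (simp add: power_vec_def)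
  qed (use vc in \<open>simp add: power_vec_def\<close>)
qed

section \<open>Jordan chains\<close>

lemma pencil_mult_vec:
  assumes "A \<in> carrier_mat m n" "B \<in> carrier_mat m n" "x \<in> carrier_vec n"
  shows "pencil A B z *\<^sub>v x = z \<cdot>\<^sub>v (cmat B *\<^sub>v x) - cmat A *\<^sub>v x"
proof -
  have "cmat A \<in> carrier_mat m n" "cmat B \<in> carrier_mat m n" using assms by auto
  then show ?thesis using assms(3)
    by (simp add: pencil_def minus_mult_distrib_mat_vec[of _ m n])
      (simp add: smult_mat_mult_vec[of _ m n])
qed

text \<open>
  Both sides of \<open>(z B - A) q\<^sub>i = (z - c) R e\<^sub>i - R e\<^sub>i\<^sub>+\<^sub>1\<close> are affine in \<open>z\<close>: the slope yields the value of
  \<open>B q\<^sub>i\<close>, and \<open>z = c\<close> yields that of \<open>(A - c B) q\<^sub>i\<close>. For \<open>i + 1 < b\<close> it follows that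
  \<open>(A - c B) q\<^sub>i = B q\<^sub>i\<^sub>+\<^sub>1\<close>, the step of a chain.
\<close>

lemma intertwined_jordan_columns:
  assumes A: "A \<in> carrier_mat m n" and B: "B \<in> carrier_mat m n" and S: "S \<in> carrier_mat n b"
    and tw: "intertwines (pencil A B) S R (jordan_pencil c b)" and R: "dim_row R = m"
    and i: "i < b"
  shows "cmat B *\<^sub>v col S i = R *\<^sub>v unit_vec b i"
    and "(cmat A - c \<cdot>\<^sub>m cmat B) *\<^sub>v col S i = R *\<^sub>v unit_vec b (i + 1)"
proof -
  let ?x = "col S i"
  have x: "?x \<in> carrier_vec n" using S by auto
  have Rc: "R \<in> carrier_mat m b" using tw R by (simp add: intertwines_def jordan_pencil_def)
  have AB: "cmat A \<in> carrier_mat m n" "cmat B \<in> carrier_mat m n" using A B by auto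
  have eq: "z \<cdot>\<^sub>v (cmat B *\<^sub>v ?x) - cmat A *\<^sub>v ?x =
      (z - c) \<cdot>\<^sub>v (R *\<^sub>v unit_vec b i) - R *\<^sub>v unit_vec b (i + 1)" for z
  proof -
    have "pencil A B z *\<^sub>v (S *\<^sub>v unit_vec b i) =
        R *\<^sub>v (eval_mat (jordan_pencil c b) z *\<^sub>v unit_vec b i)"
      using tw by (simp add: intertwines_def jordan_pencil_def)
    then show ?thesis
      using mult_mat_vec_unit[of i S] S i Rc pencil_mult_vec[OF A B x]
      by (simp add: jordan_pencil_mult_unit mult_minus_distrib_mat_vec mult_mat_vec)
  qed
  have row: "z * (cmat B *\<^sub>v ?x) $ t - (cmat A *\<^sub>v ?x) $ t =
      (z - c) * (R *\<^sub>v unit_vec b i) $ t - (R *\<^sub>v unit_vec b (i + 1)) $ t"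
    if "t < m" for z t
    using arg_cong[OF eq, of "\<lambda>w. w $ t" z] AB Rc that by (simp del: index_mult_mat_vec)
  have Bt: "(cmat B *\<^sub>v ?x) $ t = (R *\<^sub>v unit_vec b i) $ t" if "t < m" for t
  proof -
    \<comment> \<open>The slope is the difference of the values at \<open>c + 1\<close> and \<open>c\<close>.\<close>
    have "(cmat B *\<^sub>v ?x) $ t = ((c + 1) * (cmat B *\<^sub>v ?x) $ t - (cmat A *\<^sub>v ?x) $ t) -
        (c * (cmat B *\<^sub>v ?x) $ t - (cmat A *\<^sub>v ?x) $ t)"
      by (simp add: distrib_right del: index_mult_mat_vec)
    then show ?thesis unfolding row[OF that] by simp
  qed
  then show "cmat B *\<^sub>v ?x = R *\<^sub>v unit_vec b i"
    using AB Rc by (intro eq_vecI) (auto simp del: index_mult_mat_vec)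
  have *: "(cmat A - c \<cdot>\<^sub>m cmat B) *\<^sub>v ?x = cmat A *\<^sub>v ?x - c \<cdot>\<^sub>v (cmat B *\<^sub>v ?x)"
    using AB x by (simp add: minus_mult_distrib_mat_vec[of _ m n])
      (simp add: smult_mat_mult_vec[of _ m n])
  show "(cmat A - c \<cdot>\<^sub>m cmat B) *\<^sub>v ?x = R *\<^sub>v unit_vec b (i + 1)"
    unfolding *
  proof (rule eq_vecI)
    fix t assume "t < dim_vec (R *\<^sub>v unit_vec b (i + 1))"
    then have "t < m" using Rc by simp
    then show "(cmat A *\<^sub>v ?x - c \<cdot>\<^sub>v (cmat B *\<^sub>v ?x)) $ t = (R *\<^sub>v unit_vec b (i + 1)) $ t"
      using row[of t c] AB by (simp del: index_mult_mat_vec) (simp add: algebra_simps)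
  qed (use AB Rc in simp)
qed

lemma chain_vectors_nth:
  assumes "j < length bs"
  shows "length (chain_vectors M c bs j) = bs ! j"
    and "k < bs ! j \<Longrightarrow> chain_vectors M c bs j ! k =
           col (column_block M (map (jordan_pencil c) bs) j) (bs ! j - 1 - k)"
proof -
  have "dim_col (column_block M (map (jordan_pencil c) bs) j) = bs ! j"
    using assms by (simp add: column_block_slice) (simp add: jordan_pencil_def)
  then show "length (chain_vectors M c bs j) = bs ! j"
    and "k < bs ! j \<Longrightarrow> chain_vectors M c bs j ! k =
           col (column_block M (map (jordan_pencil c) bs) j) (bs ! j - 1 - k)"
    by (simp_all add: chain_vectors_def rev_nth)
qed

text \<open>
  The chain relations are the two equations of \<open>intertwined_jordan_columns\<close> for neighbouring columns;
  the last column is an eigenvector because it has no successor. No vector of the chain vanishes since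
  the columns of an injective matrix are nonzero.
\<close>

lemma root_chain_chain_vectors:
  assumes A: "A \<in> carrier_mat m n" and B: "B \<in> carrier_mat m n"
    and M: "M \<in> carrier_mat n (dim_col (J_block c bs))"
    and tw: "intertwines (pencil A B) M R (J_block c bs)" and R: "dim_row R = m"
    and inj: "mat_kernel M \<subseteq> {0\<^sub>v (dim_col M)}"
    and j: "j < length bs" and pos: "bs ! j > 0"
  shows "root_chain A B c (chain_vectors M c bs j)"
proof -
  let ?Js = "map (jordan_pencil c) bs" and ?b = "bs ! j"
  define S where "S = column_block M ?Js j"
  have Jj: "?Js ! j = jordan_pencil c ?b" "dim_col (?Js ! j) = ?b"
    using j by simp_all (simp add: jordan_pencil_def)
  have S: "S \<in> carrier_mat n ?b"
    using column_block_carrier[of M ?Js j] M Jj by (simp add: S_def)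
  obtain R' where R': "dim_row R' = m" "intertwines (pencil A B) S R' (jordan_pencil c ?b)"
    using intertwines_column_block[of "pencil A B" M R ?Js j] tw M R j
    by (auto simp: J_block_def S_def)
  have ker: "mat_kernel S \<subseteq> {0\<^sub>v ?b}"
    using kernel_column_block_trivial[of M ?Js j] M inj j Jj by (simp add: J_block_def S_def)
  have nz: "col S i \<noteq> 0\<^sub>v n" if "i < ?b" for i
  proof
    assume "col S i = 0\<^sub>v n"
    then have "unit_vec ?b i \<in> mat_kernel S"
      using S that mult_mat_vec_unit[of i S] by (simp add: mat_kernel_def)
    with ker that show False by auto
  qed
  have nth: "chain_vectors M c bs j ! k = col S (?b - 1 - k)" if "k < ?b" for k
    using chain_vectors_nth[OF j] that by (simp add: S_def)
  have len: "length (chain_vectors M c bs j) = ?b" by (rule chain_vectors_nth[OF j])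
  note eqs = intertwined_jordan_columns[OF A B S R'(2) R'(1)]
  have "R' \<in> carrier_mat m ?b" using R' by (simp add: intertwines_def jordan_pencil_def)
  then have last: "R' *\<^sub>v unit_vec ?b ?b = 0\<^sub>v m"
    by (intro eq_vecI) (auto simp: scalar_prod_def unit_vec_def)
  show ?thesis
    unfolding root_chain_def
  proof (intro conjI ballI allI impI)
    fix x assume "x \<in> set (chain_vectors M c bs j)"
    then obtain k where "k < ?b" "x = col S (?b - 1 - k)"
      using nth len by (metis in_set_conv_nth)
    then show "x \<in> carrier_vec (dim_col A)" "x \<noteq> 0\<^sub>v (dim_col A)"
      using S A nz[of "?b - 1 - k"] by auto
  next
    show "chain_vectors M c bs j \<noteq> []" using len pos by auto
  next
    show "(cmat A - c \<cdot>\<^sub>m cmat B) *\<^sub>v (chain_vectors M c bs j ! 0) = 0\<^sub>v (dim_row A)"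
      using eqs(2)[of "?b - 1"] nth[of 0] pos last A by simp
  next
    fix k assume k: "1 \<le> k \<and> k < length (chain_vectors M c bs j)"
    then have "?b - 1 - k + 1 = ?b - 1 - (k - 1)" "?b - 1 - k < ?b" "?b - 1 - (k - 1) < ?b"
      "k < ?b" "k - 1 < ?b"
      using len by auto
    then show "(cmat A - c \<cdot>\<^sub>m cmat B) *\<^sub>v (chain_vectors M c bs j ! k) =
        cmat B *\<^sub>v (chain_vectors M c bs j ! (k - 1))"
      using eqs(2)[of "?b - 1 - k"] eqs(1)[of "?b - 1 - (k - 1)"] nth by simp
  qed
qed

text \<open>
  Only cells with eigenvalue \<open>z\<close> have a kernel, spanned by the last unit vector, whose image is the
  last column of the cell and thus the head of the chain.
\<close>

lemma kernel_J_block_in_cspan: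
  assumes S: "S \<subseteq> carrier_vec n" and M: "M \<in> carrier_mat n (dim_col (J_block c bs))"
    and pos: "\<And>b. b \<in> set bs \<Longrightarrow> b > 0"
    and hd: "\<And>j. j < length bs \<Longrightarrow> c = z \<Longrightarrow> hd (chain_vectors M c bs j) \<in> S"
    and v: "v \<in> mat_kernel (eval_mat (J_block c bs) z)"
  shows "M *\<^sub>v v \<in> cspan n S"
proof (rule kernel_eval_diag_in_cspan[OF S _ _ v[unfolded J_block_def]])
  let ?Js = "map (jordan_pencil c) bs"
  show "M \<in> carrier_mat n (dim_col (diag_block_mat ?Js))" using M by (simp add: J_block_def)
  fix j w assume "j < length ?Js" and w: "w \<in> mat_kernel (eval_mat (?Js ! j) z)"
  then have j: "j < length bs" and w: "w \<in> mat_kernel (eval_mat (jordan_pencil c (bs ! j)) z)"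
    by simp_all
  let ?b = "bs ! j" and ?N = "column_block M ?Js j"
  have b: "?b > 0" using pos j by simp
  have N: "?N \<in> carrier_mat n ?b"
    using column_block_carrier[of M ?Js j] M j by (simp add: jordan_pencil_def)
  show "?N *\<^sub>v w \<in> cspan n S"
  proof (cases "c = z")
    case True
    have "hd (chain_vectors M c bs j) = ?N *\<^sub>v unit_vec ?b (?b - 1)"
      using chain_vectors_nth[OF j, where M = M and c = c] b N mult_mat_vec_unit[of "?b - 1" ?N]
      by (subst hd_conv_nth) auto
    moreover have "?N *\<^sub>v w = ?N *\<^sub>v (w $ (?b - 1) \<cdot>\<^sub>v unit_vec ?b (?b - 1))"
      using w True by (intro arg_cong[where f = "\<lambda>x. ?N *\<^sub>v x"] kernel_jordan_pencil[OF b]) simp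
    moreover have "\<dots> = w $ (?b - 1) \<cdot>\<^sub>v (?N *\<^sub>v unit_vec ?b (?b - 1))"
      by (rule mult_mat_vec[OF N unit_vec_carrier])
    ultimately show ?thesis
      using cspan_smult[OF S cspan_base[OF S hd[OF j True]]] by simp
  next
    case False
    then have "w = 0\<^sub>v ?b" using kernel_jordan_pencil_other[of z c w ?b] w by simp
    then have "?N *\<^sub>v w = 0\<^sub>v n" using N by (intro eq_vecI) auto
    then show ?thesis by (simp add: cspan_zero)
  qed
qed

section \<open>Eigenvectors in Kronecker canonical form\<close>

lemma invertible_mat_obtain_inverse:
  fixes M :: "complex mat"
  assumes "M \<in> carrier_mat n n" "invertible_mat M"
  obtains N where "N \<in> carrier_mat n n" "M * N = 1\<^sub>m n" "N * M = 1\<^sub>m n"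
proof -
  obtain N where MN: "M * N = 1\<^sub>m (dim_row M)" and NM: "N * M = 1\<^sub>m (dim_row N)"
    using assms(2) by (auto simp: invertible_mat_def inverts_mat_def)
  have "dim_col N = n" using arg_cong[OF MN, of dim_col] assms(1) by simp
  moreover have "dim_row N = n" using arg_cong[OF NM, of dim_col] assms(1) by simp
  ultimately show thesis using that[of N] MN NM assms(1) by auto
qed

theorem theorem4p4:
  fixes m n p q r s :: nat
    and A B :: "real mat"
    and P Q :: "complex mat"
    and eps l eta k alpha :: "nat \<Rightarrow> nat"
    and lam :: "nat \<Rightarrow> complex"
    and bs :: "nat \<Rightarrow> nat list"
    and Ks :: "complex poly mat list"
    and Qeps Qbeta :: "nat \<Rightarrow> complex mat"
  assumes A: "A \<in> carrier_mat m n" and B: "B \<in> carrier_mat m n"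
    and P: "P \<in> carrier_mat m m" "invertible_mat P"
    and Q: "Q \<in> carrier_mat n n" "invertible_mat Q"
    and alpha: "\<And>i. i < r \<Longrightarrow> alpha i \<ge> 1"
    and bs: "\<And>i b. i < s \<Longrightarrow> b \<in> set (bs i) \<Longrightarrow> b \<ge> 1"
    and Ks: "Ks =
        map (\<lambda>i. L_block (eps i) (l i)) [0..<p]
      @ map (\<lambda>i. LT_block (eta i) (k i)) [0..<q]
      @ map (\<lambda>i. N_block (alpha i)) [0..<r]
      @ map (\<lambda>i. J_block (lam i) (bs i)) [0..<s]"
    and KCF: "\<And>z. P * pencil A B z * Q = eval_mat (diag_block_mat Ks) z"
    and Qeps: "\<And>i. Qeps i = column_block Q Ks i"
    and Qbeta: "\<And>i. Qbeta i = column_block Q Ks (p + q + r + i)"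
  shows
    "(\<forall>i<p. eps i = 0 \<longrightarrow> vector_free_eigenvectors A B (l i) (Qeps i))
     \<and> (\<forall>i<p. eps i > 0 \<longrightarrow> value_free_eigenvector A B (eps i) (Qeps i))
     \<and> (\<forall>i<s. \<forall>j<length (bs i).
          length (chain_vectors (Qbeta i) (lam i) (bs i) j) = bs i ! j
          \<and> root_chain A B (lam i) (chain_vectors (Qbeta i) (lam i) (bs i) j))
     \<and> (\<forall>z. eigenvalue_wrt A B z \<longrightarrow>
          (\<exists>i<p. eps i = 0 \<and> l i > 0) \<or> (\<exists>i<p. eps i > 0) \<or> (\<exists>i<s. bs i \<noteq> [] \<and> z = lam i))
     \<and> (\<forall>z x. eigenvector_wrt A B z x \<longrightarrow>
          x \<in> cspan n
            ({Qeps i *\<^sub>v v | i v. i < p \<and> eps i = 0 \<and> v \<in> carrier_vec (l i) \<and> v \<noteq> 0\<^sub>v (l i)}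
             \<union> {Qeps i *\<^sub>v power_vec (eps i) z | i. i < p \<and> eps i > 0}
             \<union> {hd (chain_vectors (Qbeta i) (lam i) (bs i) j) | i j.
                  i < s \<and> j < length (bs i) \<and> lam i = z}))"
proof -
  let ?D = "diag_block_mat Ks"
  have pc: "pencil A B z \<in> carrier_mat m n" for z
    using A B unfolding pencil_def by (intro minus_carrier_mat) auto
  have len: "length Ks = p + q + r + s" by (simp add: Ks)
  have nth_L: "Ks ! i = L_block (eps i) (l i)" if "i < p" for i
    using that by (simp add: Ks nth_append)
  have nth_LT: "Ks ! (p + i) = LT_block (eta i) (k i)" if "i < q" for i
    using that by (simp add: Ks nth_append)
  have nth_N: "Ks ! (p + q + i) = N_block (alpha i)" if "i < r" for i
    using that by (simp add: Ks nth_append)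
  have nth_J: "Ks ! (p + q + r + i) = J_block (lam i) (bs i)" if "i < s" for i
    using that by (simp add: Ks nth_append)

  have "dim_row ?D = m" "dim_col ?D = n"
    using arg_cong[OF KCF[of 0], of dim_row] arg_cong[OF KCF[of 0], of dim_col] P Q
    by simp_all
  note dims = this
  obtain R where R: "R \<in> carrier_mat m m" "R * P = 1\<^sub>m m"
    using invertible_mat_obtain_inverse[OF P] by metis
  obtain Q' where Q': "Q' \<in> carrier_mat n n" "Q * Q' = 1\<^sub>m n" "Q' * Q = 1\<^sub>m n"
    using invertible_mat_obtain_inverse[OF Q] by metis
  have KCF_vec: "eval_mat ?D z *\<^sub>v v = P *\<^sub>v (pencil A B z *\<^sub>v (Q *\<^sub>v v))"
    if v: "v \<in> carrier_vec n" for z v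
  proof -
    have "P * pencil A B z \<in> carrier_mat m n" using P(1) pc by (rule mult_carrier_mat)
    from assoc_mult_mat_vec[OF this Q(1) v] KCF[of z]
      assoc_mult_mat_vec[OF P(1) pc mult_mat_vec_carrier[OF Q(1) v]]
    show ?thesis by simp
  qed
  \<comment> \<open>The canonical form with \<open>P\<close> moved to the right-hand side as \<open>R\<close>.\<close>
  have tw: "intertwines (pencil A B) Q R ?D"
    unfolding intertwines_def
  proof (intro conjI allI ballI)
    fix z and v :: "complex vec" assume "v \<in> carrier_vec (dim_col ?D)"
    then have v: "v \<in> carrier_vec n" using dims by simp
    have w: "pencil A B z *\<^sub>v (Q *\<^sub>v v) \<in> carrier_vec m"
      using mult_mat_vec_carrier[OF pc mult_mat_vec_carrier[OF Q(1) v]] .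
    then show "pencil A B z *\<^sub>v (Q *\<^sub>v v) = R *\<^sub>v (eval_mat ?D z *\<^sub>v v)"
      using assoc_mult_mat_vec[OF R(1) P(1) w] R(2) by (simp add: KCF_vec[OF v])
  qed (use R dims in auto)
  have Q_mult_inverse: "Q *\<^sub>v (Q' *\<^sub>v x) = x" if "x \<in> carrier_vec n" for x
    using assoc_mult_mat_vec[OF Q(1) Q'(1) that] Q'(2) that by simp
  have inj: "mat_kernel Q \<subseteq> {0\<^sub>v (dim_col Q)}"
  proof
    fix v assume "v \<in> mat_kernel Q"
    then have v: "v \<in> carrier_vec n" and 0: "Q *\<^sub>v v = 0\<^sub>v n"
      using Q(1) by (simp_all add: mat_kernel_def)
    have "v = Q' *\<^sub>v (Q *\<^sub>v v)"
      using assoc_mult_mat_vec[OF Q'(1) Q(1) v] Q'(3) v by simp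
    also have "\<dots> = 0\<^sub>v n" unfolding 0 using Q'(1) by (intro eq_vecI) auto
    finally show "v \<in> {0\<^sub>v (dim_col Q)}" using Q(1) by simp
  qed

  have block: "column_block Q Ks i \<in> carrier_mat n (dim_col (Ks ! i))"
    "mat_kernel (column_block Q Ks i) \<subseteq> {0\<^sub>v (dim_col (Ks ! i))}"
    "\<exists>R'. dim_row R' = m \<and> intertwines (pencil A B) (column_block Q Ks i) R' (Ks ! i)"
    if i: "i < length Ks" for i
  proof -
    show "column_block Q Ks i \<in> carrier_mat n (dim_col (Ks ! i))"
      using column_block_carrier[of Q Ks i] Q(1) by simp
    show "mat_kernel (column_block Q Ks i) \<subseteq> {0\<^sub>v (dim_col (Ks ! i))}"
      using kernel_column_block_trivial[OF _ i inj] Q(1) dims by simp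
    show "\<exists>R'. dim_row R' = m \<and> intertwines (pencil A B) (column_block Q Ks i) R' (Ks ! i)"
      using intertwines_column_block[OF tw _ i] Q(1) R(1) dims by auto
  qed

  have eigenvector: "eigenvector_wrt A B z (column_block Q Ks i *\<^sub>v v)"
    if i: "i < length Ks" and v: "v \<in> carrier_vec (dim_col (Ks ! i))"
      and nz: "v \<noteq> 0\<^sub>v (dim_col (Ks ! i))"
      and 0: "eval_mat (Ks ! i) z *\<^sub>v v = 0\<^sub>v (dim_row (Ks ! i))" for i z v
  proof -
    let ?M = "column_block Q Ks i"
    obtain R' where R': "dim_row R' = m" "intertwines (pencil A B) ?M R' (Ks ! i)"
      using block(3)[OF i] by auto
    have "pencil A B z *\<^sub>v (?M *\<^sub>v v) = R' *\<^sub>v 0\<^sub>v (dim_row (Ks ! i))"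
      using R'(2) v 0 by (simp add: intertwines_def)
    also have "\<dots> = 0\<^sub>v m"
      using R' by (intro eq_vecI) (auto simp: intertwines_def)
    finally have "pencil A B z *\<^sub>v (?M *\<^sub>v v) = 0\<^sub>v m" .
    moreover have "?M *\<^sub>v v \<noteq> 0\<^sub>v n"
      using block(2)[OF i] mat_kernelI[OF block(1)[OF i] v] nz by auto
    moreover have "?M *\<^sub>v v \<in> carrier_vec n"
      by (rule mult_mat_vec_carrier[OF block(1)[OF i] v])
    ultimately show ?thesis using A by (simp add: eigenvector_wrt_def)
  qed

  have part_i: "vector_free_eigenvectors A B (l i) (Qeps i)" if "i < p" "eps i = 0" for i
    unfolding vector_free_eigenvectors_def Qeps
  proof (intro ballI impI)
    fix v :: "complex vec" assume "v \<in> carrier_vec (l i)" "v \<noteq> 0\<^sub>v (l i)"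
    then show "eigenvector_wrt A B 0 (column_block Q Ks i *\<^sub>v v)"
      using that len by (intro eigenvector) (auto simp: nth_L L_block_def)
  qed

  have part_ii: "value_free_eigenvector A B (eps i) (Qeps i)" if i: "i < p" and e: "eps i > 0" for i
    unfolding value_free_eigenvector_def Qeps
  proof
    fix z
    \<comment> \<open>The entry \<open>z\<^sup>0\<close> makes the vector nonzero even for \<open>z = 0\<close>.\<close>
    have "power_vec (eps i) z $ 0 = 1" by (simp add: power_vec_def)
    then have "power_vec (eps i) z \<noteq> 0\<^sub>v (eps i + 1)" by auto
    then show "eigenvector_wrt A B z (column_block Q Ks i *\<^sub>v power_vec (eps i) z)"
      using i e len L_block_mult_power_vec[OF e, of "l i" z]
      by (intro eigenvector) (auto simp: nth_L L_block_def power_vec_def)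
  qed

  have part_iii: "length (chain_vectors (Qbeta i) (lam i) (bs i) j) = bs i ! j
      \<and> root_chain A B (lam i) (chain_vectors (Qbeta i) (lam i) (bs i) j)"
    if i: "i < s" and j: "j < length (bs i)" for i j
  proof
    show "length (chain_vectors (Qbeta i) (lam i) (bs i) j) = bs i ! j"
      by (rule chain_vectors_nth[OF j])
    have idx: "p + q + r + i < length Ks" using i len by simp
    obtain R' where R': "dim_row R' = m"
      "intertwines (pencil A B) (Qbeta i) R' (J_block (lam i) (bs i))"
      using block(3)[OF idx] i by (auto simp: Qbeta nth_J)
    have M: "Qbeta i \<in> carrier_mat n (dim_col (J_block (lam i) (bs i)))"
      "mat_kernel (Qbeta i) \<subseteq> {0\<^sub>v (dim_col (Qbeta i))}"
      using block(1,2)[OF idx] i by (auto simp: Qbeta nth_J)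
    have "bs i ! j > 0" using bs[OF i nth_mem[OF j]] by simp
    then show "root_chain A B (lam i) (chain_vectors (Qbeta i) (lam i) (bs i) j)"
      using root_chain_chain_vectors[OF A B M(1) R'(2,1) M(2) j] by simp
  qed

  define S where "S z =
      {Qeps i *\<^sub>v v | i v. i < p \<and> eps i = 0 \<and> v \<in> carrier_vec (l i) \<and> v \<noteq> 0\<^sub>v (l i)}
      \<union> {Qeps i *\<^sub>v power_vec (eps i) z | i. i < p \<and> eps i > 0}
      \<union> {hd (chain_vectors (Qbeta i) (lam i) (bs i) j) | i j.
           i < s \<and> j < length (bs i) \<and> lam i = z}" for z
  have S: "S z \<subseteq> carrier_vec n" for z
  proof
    fix x assume "x \<in> S z"
    then consider i v where "x = Qeps i *\<^sub>v v" "i < p" "eps i = 0" "v \<in> carrier_vec (l i)"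
        "v \<noteq> 0\<^sub>v (l i)"
      | i where "x = Qeps i *\<^sub>v power_vec (eps i) z" "i < p" "eps i > 0"
      | i j where "x = hd (chain_vectors (Qbeta i) (lam i) (bs i) j)" "i < s" "j < length (bs i)"
      unfolding S_def by blast
    then show "x \<in> carrier_vec n"
    proof cases
      case 1
      then show ?thesis
        using part_i A by (simp add: vector_free_eigenvectors_def eigenvector_wrt_def)
    next
      case 2
      then show ?thesis
        using part_ii A by (simp add: value_free_eigenvector_def eigenvector_wrt_def)
    next
      case 3
      then show ?thesis using part_iii[OF 3(2,3)] A by (simp add: root_chain_def)
    qed
  qed

  have part_v: "x \<in> cspan n (S z)" if "eigenvector_wrt A B z x" for x z
  proof -
    from that A have x: "x \<in> carrier_vec n" and 0: "pencil A B z *\<^sub>v x = 0\<^sub>v m"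
      by (simp_all add: eigenvector_wrt_def)
    define y where "y = Q' *\<^sub>v x"
    have y: "y \<in> carrier_vec n" and Qy: "Q *\<^sub>v y = x"
      using mult_mat_vec_carrier[OF Q'(1) x] Q_mult_inverse[OF x] by (simp_all add: y_def)
    have "eval_mat ?D z *\<^sub>v y = 0\<^sub>v m"
      unfolding KCF_vec[OF y] Qy 0 using P(1) by (intro eq_vecI) auto
    then have ker: "y \<in> mat_kernel (eval_mat ?D z)"
      using y dims by (simp add: mat_kernel_def)
    have "Q *\<^sub>v y \<in> cspan n (S z)"
    proof (rule kernel_eval_diag_in_cspan[OF S _ _ ker])
      show "Q \<in> carrier_mat n (dim_col ?D)" using Q dims by simp
    next
      fix idx v assume idx: "idx < length Ks" and v: "v \<in> mat_kernel (eval_mat (Ks ! idx) z)"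
      let ?M = "column_block Q Ks idx"
      note M = block(1)[OF idx]
      have zero: "?M *\<^sub>v v \<in> cspan n (S z)" if "v = 0\<^sub>v (dim_col (Ks ! idx))"
      proof -
        have "?M *\<^sub>v v = 0\<^sub>v n" unfolding that using M by (intro eq_vecI) auto
        then show ?thesis by (simp add: cspan_zero)
      qed
      have vc: "v \<in> carrier_vec (dim_col (Ks ! idx))" using v by (simp add: mat_kernel_def)
      consider "idx < p" "eps idx = 0" | "idx < p" "eps idx > 0"
        | i where "i < q" "idx = p + i" | i where "i < r" "idx = p + q + i"
        | i where "i < s" "idx = p + q + r + i"
      proof -
        have "idx < p \<or> (\<exists>i<q. idx = p + i) \<or> (\<exists>i<r. idx = p + q + i) \<or>
            (\<exists>i<s. idx = p + q + r + i)"
          using idx len by presburger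
        then show thesis using that by (cases "eps idx = 0") auto
      qed
      then show "?M *\<^sub>v v \<in> cspan n (S z)"
      proof cases
        case 1
        then have d: "dim_col (Ks ! idx) = l idx" by (simp add: nth_L L_block_def)
        show ?thesis
        proof (cases "v = 0\<^sub>v (l idx)")
          case False
          with 1 vc d have "?M *\<^sub>v v \<in> S z" unfolding S_def Qeps by auto
          then show ?thesis by (rule cspan_base[OF S])
        qed (use zero d in auto)
      next
        case 2
        have "?M *\<^sub>v power_vec (eps idx) z \<in> S z"
          using 2 unfolding S_def Qeps by auto
        from cspan_smult[OF S cspan_base[OF S this]]
        have "v $ 0 \<cdot>\<^sub>v (?M *\<^sub>v power_vec (eps idx) z) \<in> cspan n (S z)" .
        moreover have "?M *\<^sub>v v = ?M *\<^sub>v (v $ 0 \<cdot>\<^sub>v power_vec (eps idx) z)"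
          using v 2(1) nth_L[of idx]
          by (intro arg_cong[where f = "\<lambda>x. ?M *\<^sub>v x"] kernel_L_block[OF 2(2)]) simp
        moreover have "power_vec (eps idx) z \<in> carrier_vec (dim_col (Ks ! idx))"
          using 2 by (simp add: nth_L L_block_def power_vec_def)
        note mult_mat_vec[OF M this, of "v $ 0"]
        ultimately show ?thesis by simp
      next
        case 3
        then have "v = 0\<^sub>v (eta i)" "dim_col (Ks ! idx) = eta i"
          using v kernel_LT_block[of v "eta i" "k i" z] by (simp_all add: nth_LT) (simp_all add: LT_block_def)
        then show ?thesis by (intro zero) simp
      next
        case 4
        then have "v = 0\<^sub>v (alpha i)" "dim_col (Ks ! idx) = alpha i"
          using v kernel_N_block[of v "alpha i" z] by (simp_all add: nth_N) (simp_all add: N_block_def)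
        then show ?thesis by (intro zero) simp
      next
        case 5
        have "Qbeta i *\<^sub>v v \<in> cspan n (S z)"
        proof (rule kernel_J_block_in_cspan[OF S])
          show "Qbeta i \<in> carrier_mat n (dim_col (J_block (lam i) (bs i)))"
            using M 5 by (simp add: Qbeta nth_J)
          show "b > 0" if "b \<in> set (bs i)" for b using bs[OF 5(1) that] by simp
          show "hd (chain_vectors (Qbeta i) (lam i) (bs i) j) \<in> S z"
            if "j < length (bs i)" "lam i = z" for j
            using that 5(1) unfolding S_def by blast
          show "v \<in> mat_kernel (eval_mat (J_block (lam i) (bs i)) z)"
            using v 5 by (simp add: nth_J)
        qed
        then show ?thesis by (simp add: Qbeta 5(2))
      qed
    qed
    then show ?thesis by (simp add: Qy)
  qed

  have part_iv: "(\<exists>i<p. eps i = 0 \<and> l i > 0) \<or> (\<exists>i<p. eps i > 0) \<or> (\<exists>i<s. bs i \<noteq> [] \<and> z = lam i)"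
    if eigenvalue: "eigenvalue_wrt A B z" for z
  proof (rule ccontr)
    assume contra: "\<not> ?thesis"
    obtain x where x: "eigenvector_wrt A B z x" using eigenvalue by (auto simp: eigenvalue_wrt_def)
    have "S z = {}"
    proof -
      have "v = 0\<^sub>v (l i)" if "i < p" "eps i = 0" "v \<in> carrier_vec (l i)" for i and v :: "complex vec"
        using contra that by (intro eq_vecI) auto
      then show ?thesis using contra unfolding S_def by fastforce
    qed
    then have "x = 0\<^sub>v n" using part_v[OF x] by (simp add: cspan_empty)
    then show False using x A by (simp add: eigenvector_wrt_def)
  qed

  show ?thesis
    by (intro conjI allI impI part_i part_ii part_iii[THEN conjunct1] part_iii[THEN conjunct2]
        part_iv part_v[unfolded S_def]) assumption+
qed

end
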